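(* Let $K_n$ denote the complete graph with $n$ vertices. Then $$\frac{1}{4^{\frac{n(n-1)}2}}\left(1+\frac n2\right)^n\le P(K_n)\le\frac{1}{4^{\frac{n(n-1)}2}}(n+1)^n.$$ In particular, $h(K_n)\sim\log\left(\frac14\right)$ as $n\to\infty$.
   Context: Let $\Gamma$ be a finite graph without loops or multiple edges, with vertex set $V(\Gamma)$, edge set $E(\Gamma)$, and $N_\Gamma=|E(\Gamma)|$. Let $I_\Gamma\subset V(\Gamma)\times E(\Gamma)$ be the set of pairs $(v,e)$ with $v$ an endpoint of $e$ (so $|I_\Gamma|=2N_\Gamma$). An orientation prescription is a function $\omega:I_\Gamma\to\{\pm1\}$; it orients each edge of the barycentric subdivision of $\Gamma$ (whose edges join a vertex $v$ to the midpoint $b_e$ of an incident edge $e$): the edge is oriented $b_e\to v$ if $\omega(v,e)=1$, and $v\to b_e$ if $\omega(v,e)=-1$. The prescription $\omega$ is a combinatorial flow if every vertex $v\in V(\Gamma)$ has at most one outgoing edge and every midpoint $b_e$ has at most one incoming edge; equivalently, for each $v$ there is at most one $e$ with $\omega(v,e)=-1$, and for each $e$ there is at most one $v$ with $\omega(v,e)=-1$. Let $P(\Gamma)$ be the probability that a uniformly random orientation prescription is a combinatorial flow, i.e. $P(\Gamma)=4^{-N_\Gamma}\cdot\#\{\text{combinatorial flows on }\Gamma\}$. Define $h(\Gamma)=\frac{\log P(\Gamma)}{N_\Gamma}$ if $E(\Gamma)\ne\emptyset$ and $h(\Gamma)=0$ otherwise. The notation $a_n\sim a$ for a nonzero constant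 $a$ means $a_n/a\to1$, i.e. $a_n\to a$.
   Formalization: The lower bound is stated only for n other than 1 and 2, since it fails there: P(K_1) = 1 < 3/2 and P(K_2) = 3/4 < 1; the upper bound and the asymptotics of h(K_n) are as stated. *)

theory Defs
  imports
    "HOL-Library.Ramsey"
    "HOL-Library.Landau_Symbols"
    "HOL-Probability.Probability"
begin

(* A graph is a pair (V, E) of a vertex set and an edge set; an edge is the
   two-element set of its endpoints, so loops and multiple edges are impossible.
   nsets V 2 is the set of two-element subsets of V. *)

type_synonym 'a graph = "'a set \<times> 'a set set"

abbreviation vertices :: "'a graph \<Rightarrow> 'a set" where
  "vertices G \<equiv> fst G"

abbreviation edges :: "'a graph \<Rightarrow> 'a set set" where
  "edges G \<equiv> snd G"

definition finite_simple_graph :: "'a graph \<Rightarrow> bool" where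
  "finite_simple_graph G \<longleftrightarrow> finite (vertices G) \<and> edges G \<subseteq> nsets (vertices G) 2"

definition num_edges :: "'a graph \<Rightarrow> nat" where
  "num_edges G = card (edges G)"

definition complete_graph :: "nat \<Rightarrow> nat graph" where
  "complete_graph n = ({..<n}, nsets {..<n} 2)"

definition incidences :: "'a graph \<Rightarrow> ('a \<times> 'a set) set" where
  "incidences G = {(v, e). v \<in> vertices G \<and> e \<in> edges G \<and> v \<in> e}"

(* Extensional functions, so that prescriptions are determined by their
   values on the incidences and can be counted. *)
definition orientation_prescriptions :: "'a graph \<Rightarrow> ('a \<times> 'a set \<Rightarrow> int) set" where
  "orientation_prescriptions G = (incidences G \<rightarrow>\<^sub>E {1, -1})"

(* Vertices of the barycentric subdivision: Inl v is the vertex v of the graph,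
   Inr e is the midpoint of the edge e. An arc (x, y) points from x to y. *)
definition subdivision_arcs ::
    "'a graph \<Rightarrow> ('a \<times> 'a set \<Rightarrow> int) \<Rightarrow> (('a + 'a set) \<times> ('a + 'a set)) set" where
  "subdivision_arcs G \<omega> =
     {(Inr e, Inl v) | v e. (v, e) \<in> incidences G \<and> \<omega> (v, e) = 1} \<union>
     {(Inl v, Inr e) | v e. (v, e) \<in> incidences G \<and> \<omega> (v, e) = -1}"

definition combinatorial_flow :: "'a graph \<Rightarrow> ('a \<times> 'a set \<Rightarrow> int) \<Rightarrow> bool" where
  "combinatorial_flow G \<omega> \<longleftrightarrow>
     \<omega> \<in> orientation_prescriptions G \<and>
     (\<forall>v \<in> vertices G. card {a \<in> subdivision_arcs G \<omega>. fst a = Inl v} \<le> 1) \<and>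
     (\<forall>e \<in> edges G. card {a \<in> subdivision_arcs G \<omega>. snd a = Inr e} \<le> 1)"

definition flow_prob :: "'a graph \<Rightarrow> real" where
  "flow_prob G =
     measure_pmf.prob (pmf_of_set (orientation_prescriptions G)) {\<omega>. combinatorial_flow G \<omega>}"

definition flow_entropy :: "'a graph \<Rightarrow> real" where
  "flow_entropy G =
     (if edges G \<noteq> {} then ln (flow_prob G) / real (num_edges G) else 0)"

lemma finite_simple_graph_complete: "finite_simple_graph (complete_graph n)"
  by (simp add: finite_simple_graph_def complete_graph_def)

lemma num_edges_complete: "num_edges (complete_graph n) = n * (n - 1) div 2"
  by (simp add: num_edges_def complete_graph_def card_nsets choose_two)

lemma finite_incidences:
  assumes "finite_simple_graph G"
  shows "finite (incidences G)"
proof -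
  have "finite (edges G)"
    using assms finite_imp_finite_nsets finite_subset
    unfolding finite_simple_graph_def by metis
  moreover have "incidences G \<subseteq> vertices G \<times> edges G"
    by (auto simp: incidences_def)
  ultimately show ?thesis
    using assms finite_subset unfolding finite_simple_graph_def by blast
qed

lemma card_incidences:
  assumes "finite_simple_graph G"
  shows "card (incidences G) = 2 * num_edges G"
proof -
  have fin: "finite (edges G)"
    using assms finite_imp_finite_nsets finite_subset
    unfolding finite_simple_graph_def by metis
  have "incidences G = (\<lambda>(e, v). (v, e)) ` (SIGMA e:edges G. e)"
    using assms by (force simp: incidences_def finite_simple_graph_def nsets_def)
  moreover have "inj_on (\<lambda>(e, v). (v, e)) (SIGMA e:edges G. e)"
    by (auto simp: inj_on_def)
  ultimately have "card (incidences G) = card (SIGMA e:edges G. e)"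
    by (simp add: card_image)
  also have "\<dots> = (\<Sum>e\<in>edges G. card e)"
    using assms fin by (subst card_SigmaI) (auto simp: finite_simple_graph_def nsets_def)
  also have "\<dots> = (\<Sum>e\<in>edges G. 2)"
    using assms by (intro sum.cong) (auto simp: finite_simple_graph_def nsets_def)
  finally show ?thesis by (simp add: num_edges_def)
qed

lemma flow_prob_eq_count:
  assumes "finite_simple_graph G"
  shows "flow_prob G = real (card {\<omega>. combinatorial_flow G \<omega>}) / 4 ^ num_edges G"
proof -
  let ?O = "orientation_prescriptions G"
  have fin: "finite ?O"
    using finite_incidences[OF assms]
    by (auto simp: orientation_prescriptions_def intro!: finite_PiE)
  have ne: "?O \<noteq> {}"
    by (auto simp: orientation_prescriptions_def PiE_eq_empty_iff)
  have "card ?O = 2 ^ (2 * num_edges G)"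
    using finite_incidences[OF assms] card_incidences[OF assms]
    by (simp add: orientation_prescriptions_def card_PiE numeral_2_eq_2)
  hence "card ?O = 4 ^ num_edges G"
    by (simp add: power_mult)
  moreover have "?O \<inter> {\<omega>. combinatorial_flow G \<omega>} = {\<omega>. combinatorial_flow G \<omega>}"
    by (auto simp: combinatorial_flow_def)
  ultimately show ?thesis
    by (simp add: flow_prob_def measure_pmf_of_set[OF ne fin])
qed

lemma combinatorial_flow_iff:
  assumes "finite_simple_graph G" and "\<omega> \<in> orientation_prescriptions G"
  shows "combinatorial_flow G \<omega> \<longleftrightarrow>
    (\<forall>v \<in> vertices G. card {e. (v, e) \<in> incidences G \<and> \<omega> (v, e) = -1} \<le> 1) \<and>
    (\<forall>e \<in> edges G. card {v. (v, e) \<in> incidences G \<and> \<omega> (v, e) = -1} \<le> 1)"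
proof -
  have "{a \<in> subdivision_arcs G \<omega>. fst a = Inl v} =
      (\<lambda>e. (Inl v, Inr e)) ` {e. (v, e) \<in> incidences G \<and> \<omega> (v, e) = -1}" for v
    by (auto simp: subdivision_arcs_def)
  moreover have "{a \<in> subdivision_arcs G \<omega>. snd a = Inr e} =
      (\<lambda>v. (Inl v, Inr e)) ` {v. (v, e) \<in> incidences G \<and> \<omega> (v, e) = -1}" for e
    by (auto simp: subdivision_arcs_def)
  ultimately show ?thesis
    using assms by (simp add: combinatorial_flow_def card_image inj_on_def)
qed

end

(* A flow on K_n is encoded by the map g on vertices sending v to the other endpoint of the edge
   through which v flows out, and to v itself if there is none.  Flows are thus the n^n self-maps
   without two-cycles, which gives the upper bound.  A fixed pair of vertices is a two-cycle of
   n^(n-2) self-maps, so by the union bound there are at least n^n - (n choose 2) n^(n-2)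
   = n^n (n + 1) / (2n) flows; for n >= 3 this exceeds (1 + n/2)^n, because
   (1/2 + 1/n)^n <= (n + 1) / (2n). *)

theory Submission
  imports Defs "HOL-Real_Asymp.Real_Asymp"
begin

section \<open>Encoding flows on K_n by self-maps of the vertex set\<close>

definition self_maps :: "nat \<Rightarrow> (nat \<Rightarrow> nat) set" where
  "self_maps n = {..<n} \<rightarrow>\<^sub>E {..<n}"

text \<open>For e = {a, b} the set \<open>e - {v}\<close> is the singleton of the other endpoint, so
  membership forces a and b to be swapped. As a dependent product its cardinality is a product of
  factors 1 (on e) and n (off e).\<close>

definition two_cycle_maps :: "nat \<Rightarrow> nat set \<Rightarrow> (nat \<Rightarrow> nat) set" where
  "two_cycle_maps n e = (\<Pi>\<^sub>E v\<in>{..<n}. if v \<in> e then e - {v} else {..<n})"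

text \<open>A fixed point v of g gives {v, g v} = {v}, which is not an edge, so no arc leaves
  v.\<close>

definition prescription_of_map :: "nat \<Rightarrow> (nat \<Rightarrow> nat) \<Rightarrow> nat \<times> nat set \<Rightarrow> int" where
  "prescription_of_map n g =
     (\<lambda>(v, e)\<in>incidences (complete_graph n). if e = {v, g v} then -1 else 1)"

lemma incidences_complete:
  "(v, e) \<in> incidences (complete_graph n) \<longleftrightarrow> (\<exists>w. v < n \<and> w < n \<and> v \<noteq> w \<and> e = {v, w})"
  by (auto simp: incidences_def complete_graph_def nsets_2_eq doubleton_eq_iff)

lemma finite_self_maps: "finite (self_maps n)"
  by (simp add: self_maps_def finite_PiE)

lemma card_self_maps: "card (self_maps n) = n ^ n"
  by (simp add: self_maps_def card_PiE)

lemma card_two_cycle_maps: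
  assumes "e \<in> nsets {..<n} 2"
  shows "card (two_cycle_maps n e) = n ^ (n - 2)"
proof -
  have e: "e \<subseteq> {..<n}" "finite e" "card e = 2"
    using assms by (auto simp: nsets_def)
  have "card (two_cycle_maps n e) = (\<Prod>v\<in>{..<n}. if v \<in> e then 1 else n)"
    unfolding two_cycle_maps_def using e
    by (subst card_PiE) (auto intro!: prod.cong)
  also have "\<dots> = n ^ card ({..<n} - e)"
    by (simp add: prod.If_cases Diff_eq)
  also have "card ({..<n} - e) = n - 2"
    using e by (simp add: card_Diff_subset)
  finally show ?thesis .
qed

lemma prescription_of_map_in:
  "prescription_of_map n g \<in> orientation_prescriptions (complete_graph n)"
  unfolding prescription_of_map_def orientation_prescriptions_def by (rule restrict_PiE_iff[THEN iffD2]) auto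

lemma prescription_of_map_eq_neg_iff:
  assumes "(v, e) \<in> incidences (complete_graph n)"
  shows "prescription_of_map n g (v, e) = -1 \<longleftrightarrow> e = {v, g v}"
  using assms by (simp add: prescription_of_map_def)

text \<open>The sign at (v, {v, w}) tells whether g v = w, for every w other than v. If no such w is
  hit, only g v = v remains.\<close>

lemma inj_on_prescription_of_map: "inj_on (prescription_of_map n) (self_maps n)"
proof (rule inj_onI)
  fix g h
  assume gh: "g \<in> self_maps n" "h \<in> self_maps n"
    and eq: "prescription_of_map n g = prescription_of_map n h"
  have iff: "w = g v \<longleftrightarrow> w = h v" if "v < n" "w < n" "v \<noteq> w" for v w
  proof -
    have "(v, {v, w}) \<in> incidences (complete_graph n)"
      using that by (auto simp: incidences_complete)
    from prescription_of_map_eq_neg_iff[OF this, of g] prescription_of_map_eq_neg_iff[OF this, of h]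
    show ?thesis using eq by (auto simp: doubleton_eq_iff)
  qed
  show "g = h"
  proof (rule PiE_ext)
    show "g \<in> {..<n} \<rightarrow>\<^sub>E {..<n}" "h \<in> {..<n} \<rightarrow>\<^sub>E {..<n}"
      using gh by (simp_all add: self_maps_def)
    fix v assume v: "v \<in> {..<n}"
    then have "g v < n" "h v < n" using gh by (auto simp: self_maps_def PiE_iff)
    with iff[of v "g v"] iff[of v "h v"] v show "g v = h v" by (cases "g v = v") auto
  qed
qed

text \<open>Every vertex v can only leave through {v, g v}. Two arcs entering the same midpoint come
  from the two ends of that edge, and then g swaps these ends.\<close>

lemma combinatorial_flow_prescription_of_map:
  assumes g: "g \<in> self_maps n" and no_cycle: "\<And>e. e \<in> nsets {..<n} 2 \<Longrightarrow> g \<notin> two_cycle_maps n e"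
  shows "combinatorial_flow (complete_graph n) (prescription_of_map n g)"
proof -
  let ?I = "incidences (complete_graph n)" and ?\<omega> = "prescription_of_map n g"
  have "card {e. (v, e) \<in> ?I \<and> ?\<omega> (v, e) = -1} \<le> 1" for v
  proof -
    have "{e. (v, e) \<in> ?I \<and> ?\<omega> (v, e) = -1} \<subseteq> {{v, g v}}"
      by (auto simp: prescription_of_map_eq_neg_iff)
    from card_mono[OF _ this] show ?thesis by simp
  qed
  moreover have "card {v. (v, e) \<in> ?I \<and> ?\<omega> (v, e) = -1} \<le> 1"
    if e: "e \<in> edges (complete_graph n)" for e
  proof -
    have "v = w" if v: "(v, e) \<in> ?I" "?\<omega> (v, e) = -1" and w: "(w, e) \<in> ?I" "?\<omega> (w, e) = -1" for v w
    proof (rule ccontr)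
      assume "v \<noteq> w"
      moreover have "e = {v, g v}" "e = {w, g w}"
        using v w by (auto simp: prescription_of_map_eq_neg_iff)
      ultimately have "e = {v, w}" "g v = w" "g w = v" by (auto simp: doubleton_eq_iff)
      with \<open>v \<noteq> w\<close> g have "g \<in> two_cycle_maps n e"
        by (auto simp: two_cycle_maps_def self_maps_def PiE_iff)
      with no_cycle[of e] e show False by (simp add: complete_graph_def)
    qed
    \<comment> \<open>Uniqueness settles the finite case; an infinite set would have
      \<open>card\<close> 0.\<close>
    then show ?thesis
      using card_le_Suc0_iff_eq[of "{v. (v, e) \<in> ?I \<and> ?\<omega> (v, e) = -1}"]
      by (cases "finite {v. (v, e) \<in> ?I \<and> ?\<omega> (v, e) = -1}") auto
  qed
  ultimately show ?thesis
    by (simp add: combinatorial_flow_iff[OF finite_simple_graph_complete prescription_of_map_in])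
qed

text \<open>At most one arc leaves each vertex, so a map can be read off from a flow. The inclusion
  gives both the upper bound on the number of flows and their finiteness.\<close>

lemma combinatorial_flows_subset:
  "{\<omega>. combinatorial_flow (complete_graph n) \<omega>} \<subseteq> prescription_of_map n ` self_maps n"
proof
  let ?I = "incidences (complete_graph n)"
  fix \<omega> assume "\<omega> \<in> {\<omega>. combinatorial_flow (complete_graph n) \<omega>}"
  then have flow: "combinatorial_flow (complete_graph n) \<omega>" by simp
  then have \<omega>: "\<omega> \<in> ?I \<rightarrow>\<^sub>E {1, -1}"
    by (simp add: combinatorial_flow_def orientation_prescriptions_def)
  have unique: "e = e'"
    if e: "(v, e) \<in> ?I" "\<omega> (v, e) = -1" and e': "(v, e') \<in> ?I" "\<omega> (v, e') = -1" for v e e'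
  proof -
    let ?S = "{e. (v, e) \<in> ?I \<and> \<omega> (v, e) = -1}"
    have "v \<in> vertices (complete_graph n)" using e by (simp add: incidences_def)
    then have "card ?S \<le> 1"
      using flow \<omega> by (simp add: combinatorial_flow_iff[OF finite_simple_graph_complete]
          orientation_prescriptions_def)
    \<comment> \<open>Since \<open>card\<close> is 0 on infinite sets, the bound by 1 yields
      uniqueness only together with finiteness.\<close>
    moreover have "finite ?S"
    proof (rule finite_subset)
      show "?S \<subseteq> snd ` ?I" by force
      show "finite (snd ` ?I)"
        by (intro finite_imageI finite_incidences finite_simple_graph_complete)
    qed
    ultimately show ?thesis
      using card_le_Suc0_iff_eq[of ?S] e e' by simp
  qed
  define out where "out v w \<longleftrightarrow> (v, {v, w}) \<in> ?I \<and> \<omega> (v, {v, w}) = -1" for v w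
  \<comment> \<open>The default value v marks a vertex without outgoing arc; it cannot be confused
    with a genuine target, because \<open>out v v\<close> never holds.\<close>
  define g where "g = (\<lambda>v\<in>{..<n}. if \<exists>w. out v w then SOME w. out v w else v)"
  \<comment> \<open>The case w = v is excluded because the equivalence fails at fixed points of
    \<open>g\<close>.\<close>
  have out_iff: "out v w \<longleftrightarrow> w = g v" if "v < n" "w \<noteq> v" for v w
  proof
    assume vw: "out v w"
    then have "out v (g v)" using that someI[of "out v" w] by (auto simp: g_def)
    with vw unique[of v "{v, w}" "{v, g v}"] show "w = g v"
      by (auto simp: out_def doubleton_eq_iff)
  next
    assume "w = g v"
    with that show "out v w" by (auto simp: g_def intro: someI split: if_splits)
  qed
  have "g v < n" if "v < n" for v
    using out_iff[of v "g v"] that by (cases "g v = v") (auto simp: out_def incidences_complete doubleton_eq_iff)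
  then have "g \<in> self_maps n" by (auto simp: self_maps_def g_def)
  moreover have "\<omega> = prescription_of_map n g"
  proof (rule PiE_ext[OF \<omega>])
    show "prescription_of_map n g \<in> ?I \<rightarrow>\<^sub>E {1, -1}"
      using prescription_of_map_in by (simp add: orientation_prescriptions_def)
    fix p assume p: "p \<in> ?I"
    obtain v e where ve: "p = (v, e)" by (cases p)
    with p obtain w where w: "v < n" "w \<noteq> v" "e = {v, w}"
      by (metis incidences_complete)
    \<comment> \<open>With only two possible values, it suffices that both prescriptions are -1 at
      the same incidences.\<close>
    have "\<omega> p \<in> {1, -1}" using \<omega> p by (auto simp: PiE_iff)
    moreover have "\<omega> p = -1 \<longleftrightarrow> w = g v"
      using out_iff[OF w(1,2)] p ve w by (simp add: out_def)
    ultimately show "\<omega> p = prescription_of_map n g p"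
      using p ve w by (auto simp: prescription_of_map_def doubleton_eq_iff)
  qed
  ultimately show "\<omega> \<in> prescription_of_map n ` self_maps n" by blast
qed

section \<open>Counting the flows from above and below\<close>

lemma card_combinatorial_flows_le:
  "card {\<omega>. combinatorial_flow (complete_graph n) \<omega>} \<le> n ^ n"
  using surj_card_le[OF finite_self_maps combinatorial_flows_subset] by (simp add: card_self_maps)

text \<open>Maps without two-cycles yield distinct flows by injectivity, and the union bound over
  pairs controls the other maps. The additive form avoids truncated subtraction and transfers
  directly to the reals.\<close>

lemma card_combinatorial_flows_ge:
  "n ^ n \<le> card {\<omega>. combinatorial_flow (complete_graph n) \<omega>} + (n choose 2) * n ^ (n - 2)"
proof -
  let ?C = "\<Union>e\<in>nsets {..<n} 2. two_cycle_maps n e"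
  let ?F = "{\<omega>. combinatorial_flow (complete_graph n) \<omega>}"
  have finF: "finite ?F"
    using finite_subset[OF combinatorial_flows_subset] finite_self_maps by blast
  have "finite ?C"
    by (auto simp: two_cycle_maps_def finite_imp_finite_nsets nsets_def intro!: finite_PiE)
  then have "n ^ n - card ?C \<le> card (self_maps n - ?C)"
    using diff_card_le_card_Diff[of ?C "self_maps n"] by (simp add: card_self_maps)
  also have "\<dots> = card (prescription_of_map n ` (self_maps n - ?C))"
    by (rule card_image[symmetric]) (rule inj_on_subset[OF inj_on_prescription_of_map], blast)
  also have "\<dots> \<le> card ?F"
    by (rule card_mono[OF finF]) (auto intro: combinatorial_flow_prescription_of_map)
  finally have "n ^ n \<le> card ?F + card ?C" by simp
  also have "card ?C \<le> (\<Sum>e\<in>nsets {..<n} 2. card (two_cycle_maps n e))"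
    by (rule card_UN_le) (simp add: finite_imp_finite_nsets)
  also have "\<dots> = (n choose 2) * n ^ (n - 2)"
    by (simp add: card_two_cycle_maps card_nsets)
  finally show ?thesis by simp
qed

lemma half_plus_inverse_power_le:
  assumes "n \<ge> 3"
  shows "(1 / 2 + 1 / real n) ^ n \<le> (real n + 1) / (2 * real n)"
\<comment> \<open>At n = 3 the left side is 125/216, which exceeds 1/2 but not the right side 2/3.
  From n = 4 on the base is at most 3/4, and (3/4)^4 = 81/256 lies below 1/2.\<close>
proof (cases "n = 3")
  case True
  then show ?thesis by (simp add: power3_eq_cube)
next
  case False
  with assms have n: "n \<ge> 4" by simp
  then have "(1 / 2 + 1 / real n) ^ n \<le> (3 / 4) ^ n"
    by (intro power_mono) (auto simp: field_simps)
  also have "\<dots> \<le> (3 / 4 :: real) ^ 4"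
    using n by (intro power_decreasing) auto
  also have "\<dots> \<le> 1 / 2" by (simp add: power_divide)
  also have "\<dots> \<le> (real n + 1) / (2 * real n)"
    using n by (simp add: field_simps)
  finally show ?thesis .
qed

text \<open>The two excluded values are genuine exceptions: K_1 has 1 flow against 3/2, and K_2 has
  3 flows against 4.\<close>

lemma card_combinatorial_flows_ge_power:
  assumes "n \<notin> {1, 2}"
  shows "(1 + real n / 2) ^ n \<le> real (card {\<omega>. combinatorial_flow (complete_graph n) \<omega>})"
\<comment> \<open>For n = 0 the left side is 1, and the count is at least \<open>0 ^ 0 = 1\<close>,
  from the empty map.\<close>
proof (cases "n = 0")
  case True
  with card_combinatorial_flows_ge[of 0] show ?thesis by (simp add: binomial_eq_0)
next
  case False
  with assms have n: "n \<ge> 3" by simp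
  let ?c = "real (card {\<omega>. combinatorial_flow (complete_graph n) \<omega>})"
  have "n - 2 + 2 = n" using n by simp
  then have pow: "real n ^ n = real n ^ (n - 2) * real n ^ 2"
    by (metis power_add)
  have choose: "real (n choose 2) = real n * (real n - 1) / 2"
    using n by (simp add: choose_two real_of_nat_div)
  have "(1 + real n / 2) ^ n = real n ^ n * (1 / 2 + 1 / real n) ^ n"
    unfolding power_mult_distrib[symmetric] using n by (simp add: distrib_left add.commute)
  also have "\<dots> \<le> real n ^ n * ((real n + 1) / (2 * real n))"
    using n by (intro mult_left_mono half_plus_inverse_power_le) auto
  also have "\<dots> = real n ^ n - real (n choose 2) * real n ^ (n - 2)"
    unfolding pow choose using n by (simp add: field_simps power2_eq_square)
  also have "\<dots> \<le> ?c"
    using of_nat_mono[OF card_combinatorial_flows_ge[of n], where 'a = real] by simp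
  finally show ?thesis .
qed

section \<open>Bounds for P(K_n) and the limit of h(K_n)\<close>

lemma flow_prob_complete:
  "flow_prob (complete_graph n) =
     1 / 4 ^ (n * (n - 1) div 2) * real (card {\<omega>. combinatorial_flow (complete_graph n) \<omega>})"
  by (simp add: flow_prob_eq_count[OF finite_simple_graph_complete] num_edges_complete)

lemma flow_prob_complete_ge:
  assumes "n \<notin> {1, 2}"
  shows "1 / 4 ^ (n * (n - 1) div 2) * (1 + real n / 2) ^ n \<le> flow_prob (complete_graph n)"
  unfolding flow_prob_complete
  by (intro mult_left_mono card_combinatorial_flows_ge_power[OF assms]) simp

lemma flow_prob_complete_le:
  "flow_prob (complete_graph n) \<le> 1 / 4 ^ (n * (n - 1) div 2) * (real n + 1) ^ n"
proof -
  have "real (card {\<omega>. combinatorial_flow (complete_graph n) \<omega>}) \<le> real n ^ n"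
    using of_nat_mono[OF card_combinatorial_flows_le[of n], where 'a = real] by simp
  also have "\<dots> \<le> (real n + 1) ^ n" by (intro power_mono) auto
  finally show ?thesis
    unfolding flow_prob_complete by (intro mult_left_mono) simp_all
qed

lemma flow_entropy_complete_bounds:
  assumes "n \<ge> 3"
  shows "ln (1 / 4) + 2 * ln (1 + real n / 2) / (real n - 1) \<le> flow_entropy (complete_graph n)"
    and "flow_entropy (complete_graph n) \<le> ln (1 / 4) + 2 * ln (real n + 1) / (real n - 1)"
proof -
  define N where "N = n * (n - 1) div 2"
  have N: "real N = real n * (real n - 1) / 2"
    using assms by (simp add: N_def real_of_nat_div)
  then have Npos: "real N > 0" using assms by (subst N) simp
  have "card (edges (complete_graph n)) = N"
    using num_edges_complete[of n] by (simp add: num_edges_def N_def)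
  then have "edges (complete_graph n) \<noteq> {}" using Npos by auto
  then have h: "flow_entropy (complete_graph n) = ln (flow_prob (complete_graph n)) / real N"
    by (simp add: flow_entropy_def num_edges_complete N_def)
  \<comment> \<open>Both bounds have the shape 4^(-N) x^n, and n / N = 2 / (n - 1), so one
    computation serves for x = 1 + n/2 and x = n + 1.\<close>
  have ln_bound: "ln (1 / 4 ^ N * x ^ n) / real N = ln (1 / 4) + 2 * ln x / (real n - 1)"
    if "x > 0" for x :: real
  proof -
    have "ln (1 / 4 ^ N * x ^ n) = real N * ln (1 / 4) + real n * ln x"
      using that by (simp add: ln_mult ln_div ln_realpow)
    then have "ln (1 / 4 ^ N * x ^ n) / real N = ln (1 / 4) + real n * ln x / real N"
      using Npos by (simp add: add_divide_distrib)
    also have "real n * ln x / real N = 2 * ln x / (real n - 1)"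
      unfolding N using assms by (simp add: field_simps)
    finally show ?thesis .
  qed
  have lower: "1 / 4 ^ N * (1 + real n / 2) ^ n \<le> flow_prob (complete_graph n)"
    using flow_prob_complete_ge[of n] assms by (simp add: N_def)
  \<comment> \<open>A positive lower bound makes the probability itself positive, so that
    \<open>ln\<close> is monotone at it.\<close>
  have lower_pos: "0 < 1 / 4 ^ N * (1 + real n / 2) ^ n"
    by (intro mult_pos_pos zero_less_power) auto
  have upper: "flow_prob (complete_graph n) \<le> 1 / 4 ^ N * (real n + 1) ^ n"
    using flow_prob_complete_le[of n] by (simp add: N_def)
  have "ln (1 / 4 ^ N * (1 + real n / 2) ^ n) \<le> ln (flow_prob (complete_graph n))"
    using lower lower_pos by (intro ln_mono) linarith+
  from divide_right_mono[OF this, of "real N"]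
  show "ln (1 / 4) + 2 * ln (1 + real n / 2) / (real n - 1) \<le> flow_entropy (complete_graph n)"
    unfolding h by (subst ln_bound[symmetric]) simp_all
  have "ln (flow_prob (complete_graph n)) \<le> ln (1 / 4 ^ N * (real n + 1) ^ n)"
    using lower lower_pos upper by (intro ln_mono) linarith+
  from divide_right_mono[OF this, of "real N"]
  show "flow_entropy (complete_graph n) \<le> ln (1 / 4) + 2 * ln (real n + 1) / (real n - 1)"
    unfolding h by (subst ln_bound[symmetric]) simp_all
qed

text \<open>Both error terms are of order (ln n) / n, so the entropy is squeezed to its
  limit.\<close>

lemma flow_entropy_complete_tendsto:
  "(\<lambda>n. flow_entropy (complete_graph n)) \<longlonglongrightarrow> ln (1 / 4)"
proof (rule tendsto_sandwich)
  show "\<forall>\<^sub>F n in sequentially. ln (1 / 4) + 2 * ln (1 + real n / 2) / (real n - 1)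
      \<le> flow_entropy (complete_graph n)"
    using eventually_ge_at_top[of 3] by eventually_elim (rule flow_entropy_complete_bounds)
  show "\<forall>\<^sub>F n in sequentially. flow_entropy (complete_graph n)
      \<le> ln (1 / 4) + 2 * ln (real n + 1) / (real n - 1)"
    using eventually_ge_at_top[of 3] by eventually_elim (rule flow_entropy_complete_bounds)
  have "(\<lambda>n. 2 * ln (1 + real n / 2) / (real n - 1)) \<longlonglongrightarrow> 0" by real_asymp
  from tendsto_add[OF tendsto_const this]
  show "(\<lambda>n. ln (1 / 4) + 2 * ln (1 + real n / 2) / (real n - 1)) \<longlonglongrightarrow> ln (1 / 4)" by simp
  have "(\<lambda>n. 2 * ln (real n + 1) / (real n - 1)) \<longlonglongrightarrow> 0" by real_asymp
  from tendsto_add[OF tendsto_const this]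
  show "(\<lambda>n. ln (1 / 4) + 2 * ln (real n + 1) / (real n - 1)) \<longlonglongrightarrow> ln (1 / 4)" by simp
qed

theorem theorem3p6:
  shows "(\<forall>n::nat. n \<notin> {1, 2} \<longrightarrow>
            1 / 4 ^ (n * (n - 1) div 2) * (1 + real n / 2) ^ n \<le> flow_prob (complete_graph n)) \<and>
         (\<forall>n::nat.
            flow_prob (complete_graph n) \<le> 1 / 4 ^ (n * (n - 1) div 2) * (real n + 1) ^ n) \<and>
         (\<lambda>n. flow_entropy (complete_graph n)) \<sim>[at_top] (\<lambda>_. ln (1 / 4))"
  \<comment> \<open>Convergence becomes asymptotic equivalence because the limit
    \<open>ln (1 / 4)\<close> is nonzero.\<close>
  using flow_prob_complete_ge flow_prob_complete_le
    tendsto_imp_asymp_equiv_const[OF flow_entropy_complete_tendsto]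
  by simp

end
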